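(* Let $f:[0,1]\to\mathbb{R}$ be the function defined by $$f(x)=\delta_{\alpha_1(x)1}+\sum_{k=2}^{\infty}\left[\delta_{\alpha_k(x)k}\prod_{j=1}^{k-1}g_{\alpha_j(x)j}\right]\quad\text{for } x=\Delta^{Q_3^*}_{\alpha_1(x)\alpha_2(x)\ldots\alpha_k(x)\ldots}.$$ If $0\le\varepsilon_k<\frac12$ for every $k\in\mathbb{N}$, then $f$ is strictly increasing on its entire domain $[0,1]$.
   Context: Let $\|q_{ik}\|$ ($i\in\{0,1,2\}$, $k\in\mathbb{N}=\{1,2,\ldots\}$) be an infinite matrix with $q_{ik}>0$ and $q_{0k}+q_{1k}+q_{2k}=1$ for all $k$. Put $\beta_{0k}=0$, $\beta_{1k}=q_{0k}$, $\beta_{2k}=q_{0k}+q_{1k}$. For a sequence $(\alpha_k)$ with $\alpha_k\in\{0,1,2\}$ write $$\Delta^{Q_3^*}_{\alpha_1\alpha_2\ldots\alpha_k\ldots}=\beta_{\alpha_1 1}+\sum_{k=2}^{\infty}\Big[\beta_{\alpha_k k}\prod_{j=1}^{k-1}q_{\alpha_j j}\Big].$$ The matrix is assumed to define a representation of numbers, i.e. every $x\in[0,1]$ equals $\Delta^{Q_3^*}_{\alpha_1\alpha_2\ldots}$ for some sequence $\alpha_k=\alpha_k(x)$. Let $(\varepsilon_k)_{k\ge1}$ be a sequence of real numbers with $0\le\varepsilon_k\le1$. Put $g_{0k}=g_{2k}=\frac{1+\varepsilon_k}{3}$, $g_{1k}=\frac{1-2\varepsilon_k}{3}$, $\delta_{0k}=0$,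 $\delta_{1k}=g_{0k}$, $\delta_{2k}=g_{0k}+g_{1k}$. The value $f(x)$ does not depend on the choice of representation when $x$ has two representations. *)

theory Defs imports Complex_Main begin

text \<open>
  Matrices are functions of the row \<open>i \<in> {0,1,2}\<close> and the column \<open>k \<ge> 1\<close>; digit sequences are
  functions of the position \<open>k \<ge> 1\<close>. Values at \<open>k = 0\<close> are never used.
\<close>

definition offset :: "(nat \<Rightarrow> nat \<Rightarrow> real) \<Rightarrow> nat \<Rightarrow> nat \<Rightarrow> real" where
  "offset p i k = (\<Sum>j<i. p j k)"

lemma offset_simps:
  "offset p 0 k = 0" "offset p 1 k = p 0 k" "offset p 2 k = p 0 k + p 1 k"
  by (simp_all add: offset_def numeral_2_eq_2)

definition digits :: "(nat \<Rightarrow> nat) set" where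
  "digits = {a. \<forall>k\<ge>1. a k \<in> {0, 1, 2}}"

text \<open>
  The summation index of the series is shifted, so that \<open>k = 0\<close> below is its term number 2. For
  nonnegative matrices whose columns sum to 1 the terms are nonnegative with partial sums at most 1,
  so the series converges for every digit sequence.
\<close>

definition Delta :: "(nat \<Rightarrow> nat \<Rightarrow> real) \<Rightarrow> (nat \<Rightarrow> nat) \<Rightarrow> real" where
  "Delta p a = offset p (a 1) 1
     + (\<Sum>k. offset p (a (k + 2)) (k + 2) * (\<Prod>j=1..k + 1. p (a j) j))"

definition Q3_matrix :: "(nat \<Rightarrow> nat \<Rightarrow> real) \<Rightarrow> bool" where
  "Q3_matrix q \<longleftrightarrow>
     (\<forall>k\<ge>1. (\<forall>i\<in>{0, 1, 2}. q i k > 0) \<and> q 0 k + q 1 k + q 2 k = 1) \<and>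
     (\<forall>x\<in>{0..1}. \<exists>a\<in>digits. x = Delta q a)"

definition g_matrix :: "(nat \<Rightarrow> real) \<Rightarrow> nat \<Rightarrow> nat \<Rightarrow> real" where
  "g_matrix \<epsilon> i k = (if i = 1 then (1 - 2 * \<epsilon> k) / 3 else (1 + \<epsilon> k) / 3)"

text \<open>
  A choice of one representation \<open>\<alpha> x\<close> for each \<open>x \<in> [0,1]\<close>. Some numbers have two
  representations; statements about functions of \<open>\<alpha> x\<close> are made for every such choice.
\<close>

definition digit_choice :: "(nat \<Rightarrow> nat \<Rightarrow> real) \<Rightarrow> (real \<Rightarrow> nat \<Rightarrow> nat) \<Rightarrow> bool" where
  "digit_choice q \<alpha> \<longleftrightarrow> (\<forall>x\<in>{0..1}. \<alpha> x \<in> digits \<and> x = Delta q (\<alpha> x))"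

end

theory Submission imports Defs begin

text \<open>
  Cutting an expansion after \<open>n\<close> digits writes its value as \<open>H + P * T\<close>, where \<open>H\<close> and
  \<open>P > 0\<close> depend on the first \<open>n\<close> digits only and \<open>T \<in> [0,1]\<close> is the value of the remaining
  digits with respect to the remaining columns (\<open>Delta_split\<close>). Two expansions that first differ at
  position \<open>n + 1\<close> are therefore compared through their tails, and these lie in the subintervals of
  \<open>[0,1]\<close> that belong to their next digits. Hence the lexicographically smaller
  expansion has the smaller or equal value. Equality occurs only at a common endpoint of two adjacent
  subintervals, which means that the digits are \<open>c\<close> and \<open>c + 1\<close>, followed by a tail of value 1 and
  a tail of value 0, respectively (\<open>tail_less_digit\<close>).

  For \<open>\<epsilon> k < 1 / 2\<close> the columns of the matrix \<open>g\<close> are positive and sum to 1, so all this applies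
  to \<open>g\<close> as well as to \<open>q\<close>. Let \<open>x < y\<close>. By the comparison for \<open>q\<close>, the digits of \<open>x\<close> are
  lexicographically smaller than those of \<open>y\<close>, and by the comparison for \<open>g\<close>, \<open>f x \<le> f y\<close>. If
  \<open>f x = f y\<close>, then the digits of \<open>x\<close> end in \<open>c222...\<close> and those of \<open>y\<close> in \<open>(c+1)000...\<close>, because
  a tail has value 1 only if all its digits are 2, and value 0 only if all its digits are 0.
  For \<open>q\<close> the converse of the former is also true: the number 1 has an expansion, necessarily
  \<open>222...\<close>, so that all tails \<open>222...\<close> have value 1. Then the two
  digit sequences also have the same value for \<open>q\<close>, which contradicts \<open>x < y\<close>.
\<close>

section \<open>The series and its tails\<close>

definition positive_stochastic :: "(nat \<Rightarrow> nat \<Rightarrow> real) \<Rightarrow> bool" where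
  "positive_stochastic p \<longleftrightarrow>
     (\<forall>k\<ge>1. (\<forall>i\<in>{0, 1, 2}. p i k > 0) \<and> p 0 k + p 1 k + p 2 k = 1)"

definition Delta_term :: "(nat \<Rightarrow> nat \<Rightarrow> real) \<Rightarrow> (nat \<Rightarrow> nat) \<Rightarrow> nat \<Rightarrow> real" where
  "Delta_term p a k = offset p (a (Suc k)) (Suc k) * (\<Prod>j=1..k. p (a j) j)"

definition Delta_tail :: "(nat \<Rightarrow> nat \<Rightarrow> real) \<Rightarrow> (nat \<Rightarrow> nat) \<Rightarrow> nat \<Rightarrow> real" where
  "Delta_tail p a n = Delta (\<lambda>i k. p i (k + n)) (\<lambda>k. a (k + n))"

lemma Delta_tail_0 [simp]: "Delta_tail p a 0 = Delta p a"
  by (simp add: Delta_tail_def)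

lemma digits_cases:
  assumes "a \<in> digits" "k \<ge> 1"
  obtains "a k = 0" | "a k = 1" | "a k = 2"
  using assms by (auto simp: digits_def)

lemma digits_shift: "a \<in> digits \<Longrightarrow> (\<lambda>k. a (k + n)) \<in> digits"
  by (simp add: digits_def)

lemma positive_stochastic_shift:
  "positive_stochastic p \<Longrightarrow> positive_stochastic (\<lambda>i k. p i (k + n))"
  by (simp add: positive_stochastic_def)

lemma entry_pos:
  assumes "positive_stochastic p" "a \<in> digits" "k \<ge> 1"
  shows "p (a k) k > 0"
  using assms by (auto simp: positive_stochastic_def digits_def)

lemma offset_nonneg:
  assumes "positive_stochastic p" "a \<in> digits" "k \<ge> 1"
  shows "offset p (a k) k \<ge> 0"
proof -
  have "p 0 k > 0" "p 1 k > 0"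
    using assms by (auto simp: positive_stochastic_def)
  with assms(2,3) show ?thesis
    by (auto elim!: digits_cases[of a k] simp: offset_simps simp del: One_nat_def)
qed

lemma offset_eq_0_iff:
  assumes "positive_stochastic p" "a \<in> digits" "k \<ge> 1"
  shows "offset p (a k) k = 0 \<longleftrightarrow> a k = 0"
proof -
  have "p 0 k > 0" "p 1 k > 0"
    using assms by (auto simp: positive_stochastic_def)
  with assms(2,3) show ?thesis
    by (auto elim!: digits_cases[of a k] simp: offset_simps simp del: One_nat_def)
qed

lemma offset_add_le_1:
  assumes "positive_stochastic p" "a \<in> digits" "k \<ge> 1"
  shows "offset p (a k) k + p (a k) k \<le> 1"
    and "offset p (a k) k + p (a k) k = 1 \<longleftrightarrow> a k = 2"
proof -
  have "p 0 k > 0" "p 1 k > 0" "p 2 k > 0" "p 0 k + p 1 k + p 2 k = 1"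
    using assms by (auto simp: positive_stochastic_def)
  with assms(2,3) show "offset p (a k) k + p (a k) k \<le> 1"
    and "offset p (a k) k + p (a k) k = 1 \<longleftrightarrow> a k = 2"
    by (auto elim!: digits_cases[of a k] simp: offset_simps simp del: One_nat_def)
qed

lemma prod_entries_pos:
  assumes "positive_stochastic p" "a \<in> digits"
  shows "(\<Prod>j=1..n. p (a j) j) > 0"
  using entry_pos[OF assms] by (intro prod_pos) simp

lemma Delta_term_nonneg:
  assumes "positive_stochastic p" "a \<in> digits"
  shows "Delta_term p a k \<ge> 0"
  unfolding Delta_term_def
  using offset_nonneg[OF assms] prod_entries_pos[OF assms]
  by (intro mult_nonneg_nonneg) (simp_all add: less_imp_le)

text \<open>
  The numbers that share their first \<open>n\<close> digits with \<open>a\<close> lie in an interval inside \<open>[0,1]\<close> whose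
  left endpoint is the partial sum and whose length is the product.
\<close>

lemma sum_Delta_term_add_prod_le_1:
  assumes "positive_stochastic p" "a \<in> digits"
  shows "(\<Sum>k<n. Delta_term p a k) + (\<Prod>j=1..n. p (a j) j) \<le> 1"
proof (induction n)
  case (Suc n)
  let ?P = "\<Prod>j=1..n. p (a j) j"
  have "(offset p (a (Suc n)) (Suc n) + p (a (Suc n)) (Suc n)) * ?P \<le> 1 * ?P"
    using offset_add_le_1(1)[OF assms, of "Suc n"] prod_entries_pos[OF assms, of n]
    by (intro mult_right_mono) (simp_all add: less_imp_le)
  with Suc show ?case
    by (simp add: Delta_term_def algebra_simps)
qed simp

lemma sum_Delta_term_le_1:
  assumes "positive_stochastic p" "a \<in> digits"
  shows "(\<Sum>k<n. Delta_term p a k) \<le> 1"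
  using sum_Delta_term_add_prod_le_1[OF assms, of n] prod_entries_pos[OF assms, of n]
  by linarith

lemma summable_Delta_term:
  assumes "positive_stochastic p" "a \<in> digits"
  shows "summable (Delta_term p a)"
  by (rule summableI_nonneg_bounded[OF Delta_term_nonneg[OF assms] sum_Delta_term_le_1[OF assms]])

lemma Delta_eq_suminf:
  assumes "positive_stochastic p" "a \<in> digits"
  shows "Delta p a = (\<Sum>k. Delta_term p a k)"
proof -
  have "Delta p a = Delta_term p a 0 + (\<Sum>k. Delta_term p a (Suc k))"
    by (simp add: Delta_def Delta_term_def del: prod.cl_ivl_Suc)
  then show ?thesis
    using suminf_split_head[OF summable_Delta_term[OF assms]] by simp
qed

lemma Delta_bounds:
  assumes "positive_stochastic p" "a \<in> digits"
  shows "0 \<le> Delta p a" "Delta p a \<le> 1"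
  unfolding Delta_eq_suminf[OF assms]
  using suminf_nonneg[OF summable_Delta_term[OF assms] Delta_term_nonneg[OF assms]]
    suminf_le_const[OF summable_Delta_term[OF assms] sum_Delta_term_le_1[OF assms]]
  by simp_all

lemma Delta_tail_bounds:
  assumes "positive_stochastic p" "a \<in> digits"
  shows "0 \<le> Delta_tail p a n" "Delta_tail p a n \<le> 1"
  unfolding Delta_tail_def
  using Delta_bounds[OF positive_stochastic_shift[OF assms(1)] digits_shift[OF assms(2)]]
  by simp_all

lemma Delta_tail_cong:
  assumes "\<And>k. k > n \<Longrightarrow> a k = b k"
  shows "Delta_tail p a n = Delta_tail p b n"
proof -
  have "(\<Prod>j=1..k + 1. p (a (j + n)) (j + n)) = (\<Prod>j=1..k + 1. p (b (j + n)) (j + n))" for k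
    using assms by (intro prod.cong) auto
  then show ?thesis
    using assms by (simp add: Delta_tail_def Delta_def)
qed

lemma Delta_rec:
  assumes "positive_stochastic p" "a \<in> digits"
  shows "Delta p a = offset p (a 1) 1 + p (a 1) 1 * Delta_tail p a 1"
proof -
  let ?p = "\<lambda>i k. p i (k + 1)" and ?a = "\<lambda>k. a (k + 1)"
  have pa: "positive_stochastic ?p" "?a \<in> digits"
    using positive_stochastic_shift[OF assms(1)] digits_shift[OF assms(2)] by blast+
  have "(\<Prod>j=1..Suc k. p (a j) j) = p (a 1) 1 * (\<Prod>j=1..k. ?p (?a j) j)" for k
    by (subst prod.atLeast_Suc_atMost) (simp_all add: prod.shift_bounds_cl_Suc_ivl del: prod.cl_ivl_Suc)
  then have "Delta_term p a (Suc k) = p (a 1) 1 * Delta_term ?p ?a k" for k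
    by (simp add: Delta_term_def offset_def del: prod.cl_ivl_Suc)
  then have "(\<Sum>k. Delta_term p a (Suc k)) = p (a 1) 1 * (\<Sum>k. Delta_term ?p ?a k)"
    using suminf_mult[OF summable_Delta_term[OF pa]] by simp
  moreover have "Delta_term p a 0 = offset p (a 1) 1"
    by (simp add: Delta_term_def)
  ultimately show ?thesis
    using suminf_split_head[OF summable_Delta_term[OF assms]]
      Delta_eq_suminf[OF assms] Delta_eq_suminf[OF pa]
    by (simp add: Delta_tail_def)
qed

lemma Delta_tail_rec:
  assumes "positive_stochastic p" "a \<in> digits"
  shows "Delta_tail p a n = offset p (a (Suc n)) (Suc n) + p (a (Suc n)) (Suc n) * Delta_tail p a (Suc n)"
  using Delta_rec[OF positive_stochastic_shift[OF assms(1)] digits_shift[OF assms(2)], of n n]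
  by (simp add: Delta_tail_def offset_def)

lemma Delta_split:
  assumes "positive_stochastic p" "a \<in> digits"
  shows "Delta p a = (\<Sum>k<n. Delta_term p a k) + (\<Prod>j=1..n. p (a j) j) * Delta_tail p a n"
proof (induction n)
  case (Suc n)
  then show ?case
    by (simp add: Delta_term_def Delta_tail_rec[OF assms, of n] algebra_simps)
qed simp

section \<open>Extreme tails\<close>

lemma Delta_tail_eq_1D:
  assumes "positive_stochastic p" "a \<in> digits" "Delta_tail p a n = 1"
  shows "a (Suc n) = 2" "Delta_tail p a (Suc n) = 1"
proof -
  let ?o = "offset p (a (Suc n)) (Suc n)" and ?e = "p (a (Suc n)) (Suc n)"
  have e: "?e > 0" and oe: "?o + ?e \<le> 1"
    using entry_pos[OF assms(1,2)] offset_add_le_1(1)[OF assms(1,2)] by simp_all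
  have eq: "?o + ?e * Delta_tail p a (Suc n) = 1"
    using Delta_tail_rec[OF assms(1,2), of n] assms(3) by simp
  have "?e * Delta_tail p a (Suc n) \<le> ?e"
    using Delta_tail_bounds(2)[OF assms(1,2), of "Suc n"] e by simp
  with eq oe have *: "?o + ?e = 1" and "?e * Delta_tail p a (Suc n) = ?e"
    by linarith+
  with e show "Delta_tail p a (Suc n) = 1"
    by simp
  from * show "a (Suc n) = 2"
    using offset_add_le_1(2)[OF assms(1,2), of "Suc n"] by simp
qed

lemma Delta_tail_eq_0D:
  assumes "positive_stochastic p" "a \<in> digits" "Delta_tail p a n = 0"
  shows "a (Suc n) = 0" "Delta_tail p a (Suc n) = 0"
proof -
  let ?o = "offset p (a (Suc n)) (Suc n)" and ?e = "p (a (Suc n)) (Suc n)"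
  have e: "?e > 0" and o: "?o \<ge> 0"
    using entry_pos[OF assms(1,2)] offset_nonneg[OF assms(1,2)] by simp_all
  have eq: "?o + ?e * Delta_tail p a (Suc n) = 0"
    using Delta_tail_rec[OF assms(1,2), of n] assms(3) by simp
  have "?e * Delta_tail p a (Suc n) \<ge> 0"
    using Delta_tail_bounds(1)[OF assms(1,2), of "Suc n"] e by simp
  with eq o have *: "?o = 0" and "?e * Delta_tail p a (Suc n) = 0"
    by linarith+
  with e show "Delta_tail p a (Suc n) = 0"
    by simp
  from * show "a (Suc n) = 0"
    using offset_eq_0_iff[OF assms(1,2), of "Suc n"] by simp
qed

lemma Delta_tail_eq_1_later:
  assumes "positive_stochastic p" "a \<in> digits" "Delta_tail p a n = 1" "m \<ge> n"
  shows "Delta_tail p a m = 1"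
  using assms(4,3) by (induction rule: dec_induct) (simp_all add: Delta_tail_eq_1D(2)[OF assms(1,2)])

lemma Delta_tail_eq_0_later:
  assumes "positive_stochastic p" "a \<in> digits" "Delta_tail p a n = 0" "m \<ge> n"
  shows "Delta_tail p a m = 0"
  using assms(4,3) by (induction rule: dec_induct) (simp_all add: Delta_tail_eq_0D(2)[OF assms(1,2)])

lemma Delta_tail_eq_1_imp_digits_2:
  assumes "positive_stochastic p" "a \<in> digits" "Delta_tail p a n = 1" "k > n"
  shows "a k = 2"
proof -
  obtain m where "k = Suc m" "m \<ge> n"
    using assms(4) by (cases k) auto
  then show ?thesis
    using Delta_tail_eq_1D(1)[OF assms(1,2) Delta_tail_eq_1_later[OF assms(1-3)]] by simp
qed

lemma Delta_tail_eq_0_imp_digits_0: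
  assumes "positive_stochastic p" "a \<in> digits" "Delta_tail p a n = 0" "k > n"
  shows "a k = 0"
proof -
  obtain m where "k = Suc m" "m \<ge> n"
    using assms(4) by (cases k) auto
  then show ?thesis
    using Delta_tail_eq_0D(1)[OF assms(1,2) Delta_tail_eq_0_later[OF assms(1-3)]] by simp
qed

lemma Delta_tail_zeros:
  assumes "\<And>k. k > n \<Longrightarrow> a k = 0"
  shows "Delta_tail p a n = 0"
  using assms by (simp add: Delta_tail_def Delta_def offset_simps(1))

text \<open>
  The value of the tail \<open>222...\<close> after position \<open>n\<close> is \<open>1 - (\<Prod>k>n. p 2 k)\<close>, which may be less
  than 1. But if it is, then the whole sequence \<open>222...\<close> has a value less than 1 as well,
  and 1 has no expansion at all.
\<close>

lemma Delta_tail_twos: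
  assumes "positive_stochastic p" "c \<in> digits" "Delta p c = 1"
    and "\<And>k. k > n \<Longrightarrow> a k = 2"
  shows "Delta_tail p a n = 1"
proof -
  have c: "Delta_tail p c 0 = 1"
    using assms(3) by simp
  have "Delta_tail p a n = Delta_tail p c n"
    using assms(4) Delta_tail_eq_1_imp_digits_2[OF assms(1,2) c]
    by (intro Delta_tail_cong) simp
  also have "\<dots> = 1"
    by (rule Delta_tail_eq_1_later[OF assms(1,2) c]) simp
  finally show ?thesis .
qed

section \<open>Lexicographic comparison\<close>

text \<open>
  The tails lie in the intervals \<open>[offset p d (n+1), offset p (d+1) (n+1)]\<close> of their next digits
  \<open>d\<close>, and the interval of the smaller digit is to the left of that of the larger one.
\<close>

lemma tail_less_digit:
  assumes p: "positive_stochastic p" and a: "a \<in> digits" and b: "b \<in> digits"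
    and less: "a (Suc n) < b (Suc n)"
  shows "Delta_tail p a n \<le> Delta_tail p b n"
    and "Delta_tail p a n = Delta_tail p b n \<longleftrightarrow>
      b (Suc n) = Suc (a (Suc n)) \<and> Delta_tail p a (Suc n) = 1 \<and> Delta_tail p b (Suc n) = 0"
proof -
  let ?i = "a (Suc n)" and ?j = "b (Suc n)"
  define r s where "r = p ?i (Suc n) * (1 - Delta_tail p a (Suc n))"
    and "s = p ?j (Suc n) * Delta_tail p b (Suc n)"
  define gap where "gap = offset p ?j (Suc n) - offset p (Suc ?i) (Suc n)"
  have pos: "p ?i (Suc n) > 0" "p ?j (Suc n) > 0"
    using entry_pos[OF p a, of "Suc n"] entry_pos[OF p b, of "Suc n"] by simp_all
  have r: "r \<ge> 0" "r = 0 \<longleftrightarrow> Delta_tail p a (Suc n) = 1"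
    using pos Delta_tail_bounds(2)[OF p a, of "Suc n"] by (auto simp: r_def)
  have s: "s \<ge> 0" "s = 0 \<longleftrightarrow> Delta_tail p b (Suc n) = 0"
    using pos Delta_tail_bounds(1)[OF p b, of "Suc n"] by (auto simp: s_def)
  have gap: "gap \<ge> 0" "gap = 0 \<longleftrightarrow> ?j = Suc ?i"
  proof -
    have "p 1 (Suc n) > 0"
      using p by (simp add: positive_stochastic_def)
    moreover have "?i \<in> {0, 1, 2}" "?j \<in> {0, 1, 2}"
      using a b by (simp_all add: digits_def)
    ultimately show "gap \<ge> 0" "gap = 0 \<longleftrightarrow> ?j = Suc ?i"
      using less by (auto simp: gap_def offset_def numeral_2_eq_2)
  qed
  have "offset p (Suc ?i) (Suc n) = offset p ?i (Suc n) + p ?i (Suc n)"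
    by (simp add: offset_def)
  then have "Delta_tail p b n - Delta_tail p a n = gap + r + s"
    by (simp add: Delta_tail_rec[OF p a, of n] Delta_tail_rec[OF p b, of n]
        gap_def r_def s_def algebra_simps)
  then show "Delta_tail p a n \<le> Delta_tail p b n"
    and "Delta_tail p a n = Delta_tail p b n \<longleftrightarrow>
      ?j = Suc ?i \<and> Delta_tail p a (Suc n) = 1 \<and> Delta_tail p b (Suc n) = 0"
    using r s gap by auto
qed

lemma Delta_common_prefix:
  assumes p: "positive_stochastic p" and a: "a \<in> digits" and b: "b \<in> digits"
    and common: "\<And>j. 1 \<le> j \<Longrightarrow> j \<le> n \<Longrightarrow> a j = b j"
  shows "Delta p a \<le> Delta p b \<longleftrightarrow> Delta_tail p a n \<le> Delta_tail p b n"
    and "Delta p a = Delta p b \<longleftrightarrow> Delta_tail p a n = Delta_tail p b n"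
proof -
  have prod: "(\<Prod>j=1..k. p (a j) j) = (\<Prod>j=1..k. p (b j) j)" if "k \<le> n" for k
    using that common by (intro prod.cong) auto
  define P where "P = (\<Prod>j=1..n. p (b j) j)"
  have "(\<Sum>k<n. Delta_term p a k) = (\<Sum>k<n. Delta_term p b k)"
    using common prod by (intro sum.cong) (simp_all add: Delta_term_def)
  then have "Delta p b - Delta p a = P * (Delta_tail p b n - Delta_tail p a n)"
    using prod[of n]
    by (simp add: Delta_split[OF p a, of n] Delta_split[OF p b, of n] P_def right_diff_distrib)
  moreover have "P > 0"
    unfolding P_def by (rule prod_entries_pos[OF p b])
  ultimately show "Delta p a \<le> Delta p b \<longleftrightarrow> Delta_tail p a n \<le> Delta_tail p b n"
    and "Delta p a = Delta p b \<longleftrightarrow> Delta_tail p a n = Delta_tail p b n"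
    by (smt (verit) mult_eq_0_iff zero_le_mult_iff)+
qed

lemma first_difference:
  fixes a b :: "nat \<Rightarrow> nat"
  assumes "\<exists>k\<ge>1. a k \<noteq> b k"
  obtains n where "a (Suc n) \<noteq> b (Suc n)" "\<And>j. 1 \<le> j \<Longrightarrow> j \<le> n \<Longrightarrow> a j = b j"
proof -
  have ex: "\<exists>n. a (Suc n) \<noteq> b (Suc n)"
    using assms by (metis One_nat_def Suc_le_D)
  define n where "n = (LEAST n. a (Suc n) \<noteq> b (Suc n))"
  have "a (Suc n) \<noteq> b (Suc n)"
    unfolding n_def by (rule LeastI_ex[OF ex])
  moreover have "a j = b j" if "1 \<le> j" "j \<le> n" for j
    using not_less_Least[of "j - 1" "\<lambda>n. a (Suc n) \<noteq> b (Suc n)"] that by (simp add: n_def)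
  ultimately show ?thesis
    by (rule that)
qed

text \<open>
  The order of the values for \<open>q\<close> is the order of the values for any other positive stochastic
  matrix \<open>g\<close>. The expansion \<open>c\<close> of 1 excludes the case that \<open>g\<close> identifies two expansions
  \<open>c222...\<close> and \<open>(c+1)000...\<close> which \<open>q\<close> separates.
\<close>

lemma Delta_less_transfer:
  assumes q: "positive_stochastic q" and g: "positive_stochastic g"
    and c: "c \<in> digits" "Delta q c = 1"
    and a: "a \<in> digits" and b: "b \<in> digits"
    and less: "Delta q a < Delta q b"
  shows "Delta g a < Delta g b"
proof -
  have "\<exists>k\<ge>1. a k \<noteq> b k"
    using less Delta_tail_cong[of 0 a b q] by (auto simp: Suc_le_eq)
  then obtain n where diff: "a (Suc n) \<noteq> b (Suc n)"
    and common: "\<And>j. 1 \<le> j \<Longrightarrow> j \<le> n \<Longrightarrow> a j = b j"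
    by (rule first_difference) blast
  have tails: "Delta_tail q a n < Delta_tail q b n"
    using less Delta_common_prefix[OF q a b common] by (simp add: less_le)
  then have digit: "a (Suc n) < b (Suc n)"
    using diff tail_less_digit(1)[OF q b a, of n] by linarith
  have "Delta_tail g a n \<noteq> Delta_tail g b n"
  proof
    assume "Delta_tail g a n = Delta_tail g b n"
    then have adj: "b (Suc n) = Suc (a (Suc n))"
      and ends: "Delta_tail g a (Suc n) = 1" "Delta_tail g b (Suc n) = 0"
      using tail_less_digit(2)[OF g a b digit] by simp_all
    have "Delta_tail q a (Suc n) = 1"
      by (rule Delta_tail_twos[OF q c Delta_tail_eq_1_imp_digits_2[OF g a ends(1)]])
    moreover have "Delta_tail q b (Suc n) = 0"
      by (rule Delta_tail_zeros[OF Delta_tail_eq_0_imp_digits_0[OF g b ends(2)]])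
    ultimately have "Delta_tail q a n = Delta_tail q b n"
      using adj tail_less_digit(2)[OF q a b digit] by simp
    with tails show False
      by simp
  qed
  then show ?thesis
    using tail_less_digit(1)[OF g a b digit] Delta_common_prefix[OF g a b common]
    by (simp add: less_le)
qed

lemma positive_stochastic_g_matrix:
  assumes "\<forall>k\<ge>1. 0 \<le> \<epsilon> k \<and> \<epsilon> k < 1 / 2"
  shows "positive_stochastic (g_matrix \<epsilon>)"
  using assms by (auto simp: positive_stochastic_def g_matrix_def field_simps)

theorem corollary3:
  fixes q :: "nat \<Rightarrow> nat \<Rightarrow> real" and \<epsilon> :: "nat \<Rightarrow> real"
    and \<alpha> :: "real \<Rightarrow> nat \<Rightarrow> nat" and f :: "real \<Rightarrow> real"
  assumes "Q3_matrix q"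
    and "\<forall>k\<ge>1. 0 \<le> \<epsilon> k \<and> \<epsilon> k \<le> 1"
    and "digit_choice q \<alpha>"
    and "\<forall>x\<in>{0..1}. f x = Delta (g_matrix \<epsilon>) (\<alpha> x)"
    and "\<forall>k\<ge>1. 0 \<le> \<epsilon> k \<and> \<epsilon> k < 1 / 2"
  shows "strict_mono_on {0..1} f"
proof (rule strict_mono_onI)
  fix x y :: real
  assume xy: "x \<in> {0..1}" "y \<in> {0..1}" "x < y"
  have q: "positive_stochastic q"
    using assms(1) by (simp add: Q3_matrix_def positive_stochastic_def)
  have choice: "\<alpha> z \<in> digits" "Delta q (\<alpha> z) = z" if "z \<in> {0..1}" for z
    using assms(3) that unfolding digit_choice_def by metis+
  have "Delta q (\<alpha> x) < Delta q (\<alpha> y)"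
    using choice(2) xy by simp
  then have "Delta (g_matrix \<epsilon>) (\<alpha> x) < Delta (g_matrix \<epsilon>) (\<alpha> y)"
    using choice xy
    by (intro Delta_less_transfer[OF q positive_stochastic_g_matrix[OF assms(5)], of "\<alpha> 1"]) simp_all
  then show "f x < f y"
    using assms(4) xy by simp
qed

end
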